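(* Let $M$ be a left $\mathbb{O}$-module of type $(\mu,\nu)$, for arbitrary cardinalities $\mu$ and $\nu$. Then $M$ admits an $\mathbb{O}$-bimodule structure (extending its given left module structure) if and only if $\nu=0$, or equivalently, $\mathcal{A}^{-}(M)=0$. For such modules the bimodule structure is unique, and $M$ with it is isomorphic to the direct sum of bimodules $\bigoplus_{i\in S}\mathbb{O}$ for $S$ a set of cardinality $\mu$.
   Context: $\mathbb{O}$ denotes the real $8$-dimensional division algebra of octonions. A left $\mathbb{O}$-module is a real vector space $M$ with an $\mathbb{R}$-bilinear map $\mathbb{O}\times M\to M$, $(q,m)\mapsto qm$, such that $1m=m$ and $[p,q,m]=-[q,p,m]$ for all $p,q\in\mathbb{O}$, $m\in M$, where $[p,q,m]:=(pq)m-p(qm)$. Right $\mathbb{O}$-modules are defined symmetrically: an $\mathbb{R}$-bilinear action $(m,q)\mapsto mq$ with $m1=m$ and $[m,p,q]=-[m,q,p]$, where $[m,p,q]:=(mp)q-m(pq)$. An $\mathbb{O}$-bimodule is a real vector space $M$ that is both a left and a right $\mathbb{O}$-module such that $[p,q,m]=[q,m,p]=[m,p,q]$ for all $p,q\in\mathbb{O}$, $m\in M$, where $[q,m,p]:=(qm)p-q(mp)$. The algebra $\mathbb{O}$ is a bimodule over itself via left and right multiplication. For a left $\mathbb{O}$-module $M$, $\mathcal{A}(M):=\{m\in M\mid (pq)m-p(qm)=0\ \forall p,q\in\mathbb{O}\}$ and $\mathcal{A}^{-}(M):=\{m\in M\mid (pq)m-q(pm)=0\ \forall p,q\in\mathbb{O}\}$.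 The type of $M$ is the pair $(\dim_{\mathbb{R}}\mathcal{A}(M),\dim_{\mathbb{R}}\mathcal{A}^{-}(M))$. *)

theory Defs
  imports "HOL-Analysis.Analysis"
begin

unbundle cardinal_syntax

section \<open>Octonions\<close>

text \<open>
  Cayley--Dickson doubling with the convention
  \<open>(a, b) (c, d) = (a c - d\<^sup>* b, d a + b c\<^sup>*)\<close>, \<open>(a, b)\<^sup>* = (a\<^sup>*, - b)\<close>, applied first to the
  complex numbers (giving the quaternions) and then to the quaternions. The vector space structure
  on pairs is the product structure of the library.
\<close>

type_synonym quaternion = "complex \<times> complex"

definition quat_mult :: "quaternion \<Rightarrow> quaternion \<Rightarrow> quaternion" where
  "quat_mult x y =
     (fst x * fst y - cnj (snd y) * snd x, snd y * fst x + snd x * cnj (fst y))"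

definition quat_cnj :: "quaternion \<Rightarrow> quaternion" where
  "quat_cnj x = (cnj (fst x), - snd x)"

datatype octonion = Octonion (left_part: quaternion) (right_part: quaternion)

instantiation octonion :: real_vector
begin

definition "0 = Octonion 0 0"
definition "x + y = Octonion (left_part x + left_part y) (right_part x + right_part y)"
definition "x - y = Octonion (left_part x - left_part y) (right_part x - right_part y)"
definition "- x = Octonion (- left_part x) (- right_part x)"
definition "r *\<^sub>R x = Octonion (r *\<^sub>R left_part x) (r *\<^sub>R right_part x)"

instance
  by standard
    (simp_all add: zero_octonion_def plus_octonion_def minus_octonion_def uminus_octonion_def
      scaleR_octonion_def scaleR_add_left scaleR_add_right octonion.expand)

end

instantiation octonion :: "{one, times}"
begin

definition "1 = Octonion (1, 0) 0"
definition "x * y = Octonion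
   (quat_mult (left_part x) (left_part y) - quat_mult (quat_cnj (right_part y)) (right_part x))
   (quat_mult (right_part y) (left_part x) + quat_mult (right_part x) (quat_cnj (left_part y)))"

instance ..

end

lemmas octonion_arith_defs =
  zero_octonion_def plus_octonion_def minus_octonion_def uminus_octonion_def scaleR_octonion_def
  one_octonion_def times_octonion_def quat_mult_def quat_cnj_def

lemma octonion_mult_1:
  fixes x :: octonion
  shows "1 * x = x" "x * 1 = x"
  by (cases x; simp add: octonion_arith_defs zero_prod_def)+

text \<open>
  The multiplication is bilinear and admits composition with the Euclidean square norm, so this is
  an eight-dimensional composition division algebra.
\<close>

lemma bilinear_octonion_mult: "bilinear ((*) :: octonion \<Rightarrow> octonion \<Rightarrow> octonion)"
  unfolding bilinear_def
  by (auto intro!: linearI simp: octonion_arith_defs algebra_simps)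

definition octonion_sqnorm :: "octonion \<Rightarrow> real" where
  "octonion_sqnorm x =
     (norm (fst (left_part x)))\<^sup>2 + (norm (snd (left_part x)))\<^sup>2
     + (norm (fst (right_part x)))\<^sup>2 + (norm (snd (right_part x)))\<^sup>2"

lemma octonion_sqnorm_eq_0_iff: "octonion_sqnorm x = 0 \<longleftrightarrow> x = 0"
  by (cases x)
    (auto simp: octonion_sqnorm_def zero_octonion_def zero_prod_def prod_eq_iff
      add_nonneg_eq_0_iff)

lemma octonion_sqnorm_mult: "octonion_sqnorm (x * y) = octonion_sqnorm x * octonion_sqnorm y"
  by (simp add: octonion_sqnorm_def octonion_arith_defs cmod_power2)
    (simp add: power2_eq_square algebra_simps)


section \<open>Modules and bimodules\<close>

text \<open>
  A module is a real vector space (a type of class \<open>real_vector\<close>) together with an action: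
  \<open>lm q m\<close> stands for the left action \<open>q m\<close> and \<open>rm m q\<close> for the right action \<open>m q\<close>.
\<close>

definition left_assoc :: "(octonion \<Rightarrow> 'm::real_vector \<Rightarrow> 'm) \<Rightarrow> octonion \<Rightarrow> octonion \<Rightarrow> 'm \<Rightarrow> 'm" where
  "left_assoc lm p q m = lm (p * q) m - lm p (lm q m)"

definition right_assoc :: "('m::real_vector \<Rightarrow> octonion \<Rightarrow> 'm) \<Rightarrow> 'm \<Rightarrow> octonion \<Rightarrow> octonion \<Rightarrow> 'm" where
  "right_assoc rm m p q = rm (rm m p) q - rm m (p * q)"

definition mid_assoc ::
  "(octonion \<Rightarrow> 'm::real_vector \<Rightarrow> 'm) \<Rightarrow> ('m \<Rightarrow> octonion \<Rightarrow> 'm) \<Rightarrow> octonion \<Rightarrow> 'm \<Rightarrow> octonion \<Rightarrow> 'm" where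
  "mid_assoc lm rm q m p = rm (lm q m) p - lm q (rm m p)"

definition left_octonion_module :: "(octonion \<Rightarrow> 'm::real_vector \<Rightarrow> 'm) \<Rightarrow> bool" where
  "left_octonion_module lm \<longleftrightarrow>
     bilinear lm \<and> (\<forall>m. lm 1 m = m) \<and>
     (\<forall>p q m. left_assoc lm p q m = - left_assoc lm q p m)"

definition right_octonion_module :: "('m::real_vector \<Rightarrow> octonion \<Rightarrow> 'm) \<Rightarrow> bool" where
  "right_octonion_module rm \<longleftrightarrow>
     bilinear rm \<and> (\<forall>m. rm m 1 = m) \<and>
     (\<forall>m p q. right_assoc rm m p q = - right_assoc rm m q p)"

definition octonion_bimodule ::
  "(octonion \<Rightarrow> 'm::real_vector \<Rightarrow> 'm) \<Rightarrow> ('m \<Rightarrow> octonion \<Rightarrow> 'm) \<Rightarrow> bool" where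
  "octonion_bimodule lm rm \<longleftrightarrow>
     left_octonion_module lm \<and> right_octonion_module rm \<and>
     (\<forall>p q m. left_assoc lm p q m = mid_assoc lm rm q m p \<and>
              mid_assoc lm rm q m p = right_assoc rm m p q)"

lemma octonion_bimodule_self: "octonion_bimodule (*) ((*) :: octonion \<Rightarrow> octonion \<Rightarrow> octonion)"
  unfolding octonion_bimodule_def left_octonion_module_def right_octonion_module_def
  using bilinear_octonion_mult
  by (auto simp: left_assoc_def right_assoc_def mid_assoc_def
      octonion_arith_defs algebra_simps zero_prod_def[symmetric])


section \<open>Associative and conjugate-associative elements, type of a left module\<close>

definition assoc_elems :: "(octonion \<Rightarrow> 'm::real_vector \<Rightarrow> 'm) \<Rightarrow> 'm set" where
  "assoc_elems lm = {m. \<forall>p q. lm (p * q) m - lm p (lm q m) = 0}"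

definition conj_assoc_elems :: "(octonion \<Rightarrow> 'm::real_vector \<Rightarrow> 'm) \<Rightarrow> 'm set" where
  "conj_assoc_elems lm = {m. \<forall>p q. lm (p * q) m - lm q (lm p m) = 0}"

text \<open>
  The library's \<open>dim\<close> is a natural number and does not distinguish infinite dimensions, so
  dimension is expressed through cardinals: \<open>\<kappa>\<close> is the dimension of \<open>V\<close> iff some basis of \<open>V\<close>
  has cardinality \<open>\<kappa>\<close>.
\<close>

definition has_real_dim :: "'a::real_vector set \<Rightarrow> 'k rel \<Rightarrow> bool" where
  "has_real_dim V \<kappa> \<longleftrightarrow> (\<exists>B. independent B \<and> span B = V \<and> |B| =o \<kappa>)"

definition module_has_type ::
  "(octonion \<Rightarrow> 'm::real_vector \<Rightarrow> 'm) \<Rightarrow> 'k rel \<Rightarrow> 'l rel \<Rightarrow> bool" where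
  "module_has_type lm \<mu> \<nu> \<longleftrightarrow>
     has_real_dim (assoc_elems lm) \<mu> \<and> has_real_dim (conj_assoc_elems lm) \<nu>"


section \<open>Direct sums of copies of the octonions\<close>

definition octonion_direct_sum :: "'s set \<Rightarrow> ('s \<Rightarrow> octonion) set" where
  "octonion_direct_sum S = {f. finite {i. f i \<noteq> 0} \<and> {i. f i \<noteq> 0} \<subseteq> S}"

text \<open>
  The direct sum carries the componentwise real vector space structure and the componentwise left
  and right actions.
\<close>

definition bimodule_iso_direct_sum ::
  "(octonion \<Rightarrow> 'm::real_vector \<Rightarrow> 'm) \<Rightarrow> ('m \<Rightarrow> octonion \<Rightarrow> 'm) \<Rightarrow> 's set \<Rightarrow> bool" where
  "bimodule_iso_direct_sum lm rm S \<longleftrightarrow>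
     (\<exists>\<phi> :: 'm \<Rightarrow> 's \<Rightarrow> octonion.
        bij_betw \<phi> UNIV (octonion_direct_sum S) \<and>
        (\<forall>x y. \<phi> (x + y) = (\<lambda>i. \<phi> x i + \<phi> y i)) \<and>
        (\<forall>r x. \<phi> (r *\<^sub>R x) = (\<lambda>i. r *\<^sub>R \<phi> x i)) \<and>
        (\<forall>q x. \<phi> (lm q x) = (\<lambda>i. q * \<phi> x i)) \<and>
        (\<forall>x q. \<phi> (rm x q) = (\<lambda>i. \<phi> x i * q)))"

end

theory Submission
  imports Defs
begin

text \<open>
  By alternativity, the left multiplications \<open>L\<^sub>1, \<dots>, L\<^sub>7\<close> by the imaginary units \<open>e\<^sub>1, \<dots>, e\<^sub>7\<close>
  anticommute and square to \<open>- 1\<close>, so a left module is a module over the Clifford algebra on seven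
  generators. Its volume element \<open>L\<^sub>1 \<cdots> L\<^sub>7\<close> is a central involution. On its \<open>- 1\<close> eigenspace every
  element \<open>m\<close> has an expansion \<open>m = (\<Sum>\<^sub>i e\<^sub>i P (e\<^sub>i\<^sup>* m))\<close> that imitates the expansion of an octonion
  in the units. Here \<open>P\<close> is the expression in the \<open>L\<^sub>i\<close> that computes the real part on the octonions,
  and it takes values in the associative elements (\<open>assoc_part_in_assoc_elems\<close>,
  \<open>assoc_part_decomposition\<close>). Conjugating the action exchanges the two eigenspaces and exchanges
  associative with conjugate-associative elements. So if there are no nonzero conjugate-associative
  elements, the volume element is \<open>- 1\<close> everywhere (\<open>volume_eq_uminus\<close>) and the associative elements
  generate the module. Since \<open>P (q a) = Re q a\<close> for associative \<open>a\<close>, a real basis of the associative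
  elements is even an octonionic basis: the module is a direct sum of copies of the octonions, and
  the bimodule structure of the octonions carries over (\<open>free_bimodule\<close>).

  Conversely, in a bimodule the Teichmueller identity relates the right action to the left one. It
  shows that associative elements commute with all octonions (\<open>assoc_elems_commute\<close>), which gives
  uniqueness of the right action, and that a conjugate-associative element \<open>m\<close> satisfies
  \<open>m e\<^sub>1 = - e\<^sub>1 m\<close>, which contradicts the same identity for three units that generate the octonions
  unless \<open>m = 0\<close> (\<open>conj_assoc_elems_trivial\<close>).
\<close>


section \<open>Octonion units and the Fano plane\<close>

text \<open>
  The units \<open>1, i, j, k, l, i l, j l, k l\<close> of the doubling construction, in this order, so
  that the index \<open>0\<close> is the real unit and \<open>1, \<dots>, 7\<close> are the imaginary ones.
\<close>

definition octonion_unit :: "nat \<Rightarrow> octonion" where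
  "octonion_unit i =
     [Octonion (1, 0) 0, Octonion (\<i>, 0) 0, Octonion (0, 1) 0, Octonion (0, \<i>) 0,
      Octonion 0 (1, 0), Octonion 0 (\<i>, 0), Octonion 0 (0, 1), Octonion 0 (0, \<i>)] ! i"

definition octonion_cnj :: "octonion \<Rightarrow> octonion" where
  "octonion_cnj x = Octonion (quat_cnj (left_part x)) (- right_part x)"

definition octonion_re :: "octonion \<Rightarrow> real" where
  "octonion_re x = Re (fst (left_part x))"

lemma less_8_cases:
  fixes i :: nat
  assumes "i < 8"
  shows "i = 0 \<or> i = 1 \<or> i = 2 \<or> i = 3 \<or> i = 4 \<or> i = 5 \<or> i = 6 \<or> i = 7"
  using assms by linarith

lemmas octonion_mult_simps =
  bilinear_ladd[OF bilinear_octonion_mult] bilinear_radd[OF bilinear_octonion_mult]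
  bilinear_lsub[OF bilinear_octonion_mult] bilinear_rsub[OF bilinear_octonion_mult]
  bilinear_lneg[OF bilinear_octonion_mult] bilinear_rneg[OF bilinear_octonion_mult]
  bilinear_lmul[OF bilinear_octonion_mult] bilinear_rmul[OF bilinear_octonion_mult]
  bilinear_lzero[OF bilinear_octonion_mult] bilinear_rzero[OF bilinear_octonion_mult]

lemma octonion_unit_0: "octonion_unit 0 = 1"
  by (simp add: octonion_unit_def one_octonion_def)

lemma octonion_unit_square:
  assumes "0 < i" "i < 8"
  shows "octonion_unit i * octonion_unit i = - 1"
  using less_8_cases[OF assms(2)] assms(1)
  by (auto simp: octonion_unit_def octonion_arith_defs zero_prod_def)

lemma octonion_unit_anticommute:
  assumes "0 < i" "i < j" "j < 8"
  shows "octonion_unit j * octonion_unit i = - (octonion_unit i * octonion_unit j)"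
  using less_8_cases[of i] less_8_cases[of j] assms
  by (auto simp: octonion_unit_def octonion_arith_defs zero_prod_def)

text \<open>
  The coordinates are those of the Euclidean inner product \<open>Re (x\<^sup>* y)\<close>, for which the units are
  orthonormal.
\<close>

lemma octonion_unit_expansion:
  "x = (\<Sum>i<8. octonion_re (octonion_cnj (octonion_unit i) * x) *\<^sub>R octonion_unit i)"
  by (cases x) (simp add: eval_nat_numeral lessThan_Suc octonion_unit_def octonion_cnj_def octonion_re_def
      octonion_arith_defs prod_eq_iff complex_eq_iff)

lemma octonion_eq_0I:
  assumes "\<And>i. i < 8 \<Longrightarrow> octonion_re (octonion_cnj (octonion_unit i) * x) = 0"
  shows "x = 0"
  by (subst octonion_unit_expansion[of x]) (simp add: assms)

text \<open>
  This reduces bilinear identities such as the associativity of an element to the finitely many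
  units.
\<close>

lemma octonion_linear_eqI:
  fixes f g :: "octonion \<Rightarrow> 'a::real_vector"
  assumes "linear f" "linear g" and "\<And>i. i < 8 \<Longrightarrow> f (octonion_unit i) = g (octonion_unit i)"
  shows "f x = g x"
proof -
  have expand: "h x = (\<Sum>i<8. octonion_re (octonion_cnj (octonion_unit i) * x) *\<^sub>R h (octonion_unit i))"
    if "linear h" for h :: "octonion \<Rightarrow> 'a"
    by (subst octonion_unit_expansion[of x]) (simp add: linear_sum[OF that] linear_cmul[OF that])
  show ?thesis
    unfolding expand[OF assms(1)] expand[OF assms(2)]
    by (rule sum.cong) (simp_all add: assms(3))
qed

lemma octonion_cnj_mult: "octonion_cnj (p * q) = octonion_cnj q * octonion_cnj p"
  by (simp add: octonion_cnj_def octonion_arith_defs algebra_simps)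

lemma linear_octonion_cnj: "linear octonion_cnj"
  by (auto intro!: linearI simp: octonion_cnj_def octonion_arith_defs)

lemma octonion_cnj_cnj [simp]: "octonion_cnj (octonion_cnj q) = q"
  by (cases q) (simp add: octonion_cnj_def octonion_arith_defs)

lemma octonion_cnj_one [simp]: "octonion_cnj 1 = 1"
  by (simp add: octonion_cnj_def octonion_arith_defs)

lemma octonion_cnj_unit: "0 < i \<Longrightarrow> i < 8 \<Longrightarrow> octonion_cnj (octonion_unit i) = - octonion_unit i"
  using less_8_cases[of i]
  by (auto simp: octonion_cnj_def octonion_unit_def octonion_arith_defs zero_prod_def)

text \<open>
  The seven lines of the Fano plane on the indices of the imaginary units, each listed in a cyclic
  order \<open>(i, j, k)\<close> in which \<open>e\<^sub>i e\<^sub>j = e\<^sub>k\<close>.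
\<close>

definition fano_lines :: "(nat \<times> nat \<times> nat) set" where
  "fano_lines = {(1, 2, 3), (1, 4, 5), (2, 4, 6), (3, 4, 7), (1, 7, 6), (2, 5, 7), (3, 6, 5)}"

lemma fano_lines_mult:
  assumes "(i, j, k) \<in> fano_lines"
  shows "octonion_unit i * octonion_unit j = octonion_unit k"
    "octonion_unit j * octonion_unit k = octonion_unit i"
    "octonion_unit k * octonion_unit i = octonion_unit j"
  using assms by (auto simp: fano_lines_def octonion_unit_def octonion_arith_defs zero_prod_def)

lemma fano_line_through:
  assumes "i \<in> {1..<8}" "j \<in> {1..<8}" "i \<noteq> j"
  obtains k where "(i, j, k) \<in> fano_lines \<or> (j, k, i) \<in> fano_lines \<or> (k, i, j) \<in> fano_lines
    \<or> (j, i, k) \<in> fano_lines \<or> (i, k, j) \<in> fano_lines \<or> (k, j, i) \<in> fano_lines"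
proof -
  have "\<exists>k\<in>{1,2,3,4,5,6,7}. (i, j, k) \<in> fano_lines \<or> (j, k, i) \<in> fano_lines \<or> (k, i, j) \<in> fano_lines
    \<or> (j, i, k) \<in> fano_lines \<or> (i, k, j) \<in> fano_lines \<or> (k, j, i) \<in> fano_lines"
  proof -
    have "i = 1 \<or> i = 2 \<or> i = 3 \<or> i = 4 \<or> i = 5 \<or> i = 6 \<or> i = 7"
      "j = 1 \<or> j = 2 \<or> j = 3 \<or> j = 4 \<or> j = 5 \<or> j = 6 \<or> j = 7"
      using assms(1,2) less_8_cases[of i] less_8_cases[of j] by auto
    then show ?thesis
      using assms(3) unfolding fano_lines_def
      by (elim disjE; simp)
  qed
  then show ?thesis using that by blast
qed

text \<open>
  The operator \<open>T\<^sub>l = L\<^sub>i L\<^sub>j L\<^sub>k\<close> of a line \<open>l = (i, j, k)\<close> multiplies \<open>1\<close> by \<open>- 1\<close>. On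
  \<open>e\<^sub>n\<close> with \<open>n \<ge> 1\<close> it is multiplication by \<open>- 1\<close> for the three lines through \<open>n\<close> and by \<open>1\<close> for
  the four others. Hence \<open>1 - (\<Sum>\<^sub>l T\<^sub>l)\<close> is \<open>8\<close> on the real unit and \<open>0\<close> on every imaginary one: it
  extracts the real part by left multiplications alone.
\<close>

lemma fano_lines_real_part:
  "q - (\<Sum>(i, j, k)\<in>fano_lines. octonion_unit i * (octonion_unit j * (octonion_unit k * q)))
   = (8 * octonion_re q) *\<^sub>R 1"
  by (cases q) (simp add: fano_lines_def octonion_unit_def octonion_re_def
      octonion_arith_defs prod_eq_iff complex_eq_iff)

text \<open>
  The associator of three distinct imaginary units whose indices do not lie on one line is twice
  their product up to sign, and every imaginary unit is such a product.
\<close>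

lemma octonion_unit_associator:
  assumes "0 < i" "i < 8"
  obtains p q r where "octonion_unit i = left_assoc (*) p q r"
proof -
  \<comment> \<open>In \<open>(i, j, k, l)\<close> the last three indices are ordered so that the sign is positive; the factor
    \<open>1/2\<close> below normalizes the associator.\<close>
  let ?W = "{(1, 2, 5, 6), (2, 1, 4, 7), (3, 1, 6, 4), (4, 1, 3, 6), (5, 1, 2, 6), (6, 1, 4, 3),
    (7, 1, 2, 4)} :: (nat \<times> nat \<times> nat \<times> nat) set"
  have "\<exists>j k l. (i, j, k, l) \<in> ?W"
    using less_8_cases[OF assms(2)] assms(1) by auto
  moreover have "octonion_unit i =
      left_assoc (*) (octonion_unit j) (octonion_unit k) ((1/2) *\<^sub>R octonion_unit l)"
    if "(i, j, k, l) \<in> ?W" for j k l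
    using that
    by (auto simp: octonion_unit_def left_assoc_def octonion_arith_defs zero_prod_def complex_eq_iff)
  ultimately have "\<exists>p q r. octonion_unit i = left_assoc (*) p q r"
    by blast
  then show ?thesis
    using that by blast
qed


section \<open>Left modules over the octonions as Clifford modules\<close>

locale left_octonion_action =
  fixes lm :: "octonion \<Rightarrow> 'm::real_vector \<Rightarrow> 'm"
  assumes left_module: "left_octonion_module lm"
begin

lemma bilinear_action: "bilinear lm"
  using left_module by (simp add: left_octonion_module_def)

lemma act_one [simp]: "lm 1 m = m"
  using left_module by (simp add: left_octonion_module_def)

lemmas act_simps =
  bilinear_ladd[OF bilinear_action] bilinear_radd[OF bilinear_action]
  bilinear_lsub[OF bilinear_action] bilinear_rsub[OF bilinear_action]
  bilinear_lneg[OF bilinear_action] bilinear_rneg[OF bilinear_action]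
  bilinear_lmul[OF bilinear_action] bilinear_rmul[OF bilinear_action]
  bilinear_lzero[OF bilinear_action] bilinear_rzero[OF bilinear_action]

lemma linear_act: "linear (lm q)" "linear (\<lambda>q. lm q m)"
  using bilinear_action by (auto simp: bilinear_def)

text \<open>
  Alternativity is exactly this linearized form of \<open>p (p m) = (p p) m\<close>. It says nothing about the
  antisymmetric part of \<open>p (q m)\<close>, which is why modules of two kinds arise.
\<close>

lemma act_symmetrized: "lm p (lm q m) + lm q (lm p m) = lm (p * q + q * p) m"
proof -
  have "left_assoc lm p q m = - left_assoc lm q p m"
    using left_module unfolding left_octonion_module_def by blast
  then have "lm (p * q) m - lm p (lm q m) + (lm (q * p) m - lm q (lm p m)) = 0"
    by (simp only: left_assoc_def left_minus)
  moreover have "lm (p * q + q * p) m - (lm p (lm q m) + lm q (lm p m))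
      = lm (p * q) m - lm p (lm q m) + (lm (q * p) m - lm q (lm p m))"
    by (simp only: bilinear_ladd[OF bilinear_action] add_diff_add)
  ultimately show ?thesis by (simp only: eq_iff_diff_eq_0[symmetric])
qed

text \<open>
  By the next lemmas the operators of the seven imaginary units satisfy the relations of a Clifford
  algebra.
\<close>

abbreviation L :: "nat \<Rightarrow> 'm \<Rightarrow> 'm" where
  "L i \<equiv> lm (octonion_unit i)"

lemma L_square: "0 < i \<Longrightarrow> i < 8 \<Longrightarrow> L i (L i m) = - m"
proof -
  assume i: "0 < i" "i < 8"
  have "2 *\<^sub>R L i (L i m) = 2 *\<^sub>R (- m)"
    using act_symmetrized[of "octonion_unit i" "octonion_unit i" m]
    by (simp add: octonion_unit_square[OF i] act_simps scaleR_2)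
  then show ?thesis by (simp only: scaleR_cancel_left) simp
qed

lemma L_sort: "0 < i \<Longrightarrow> i < j \<Longrightarrow> j < 8 \<Longrightarrow> L j (L i m) = - L i (L j m)"
  using act_symmetrized[of "octonion_unit i" "octonion_unit j" m]
  by (simp add: octonion_unit_anticommute act_simps eq_neg_iff_add_eq_0 add.commute)

text \<open>
  As rewrite rules, the Clifford relations bring every word in the operators \<open>L i\<close> to a signed
  word with strictly increasing indices.
\<close>

lemmas L_normal = L_sort L_square act_simps

text \<open>
  The volume element of the Clifford algebra on seven generators. It is central and squares to
  \<open>1\<close>, so its eigenspaces split the module; it is \<open>- 1\<close> on the octonions.
\<close>

definition volume :: "'m \<Rightarrow> 'm" where
  "volume m = L 1 (L 2 (L 3 (L 4 (L 5 (L 6 (L 7 m))))))"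

text \<open>
  On the octonions this is the real part, by the identity for the lines of the Fano plane. In
  general it is, on the \<open>- 1\<close> eigenspace of the volume element, the projection onto the
  associative elements.
\<close>

definition assoc_part :: "'m \<Rightarrow> 'm" where
  "assoc_part m = (1/8) *\<^sub>R (m - (\<Sum>(i, j, k)\<in>fano_lines. L i (L j (L k m))))"

lemma linear_assoc_part: "linear assoc_part"
  by (auto intro!: linearI simp: assoc_part_def fano_lines_def act_simps algebra_simps)

lemma volume_volume: "volume (volume m) = m"
  by (simp add: volume_def L_normal del: One_nat_def)

lemma L_swap:
  assumes "i \<in> {1..<8}" "a \<in> {1..<8}"
  shows "L i (L a x) = (if i = a then L a (L i x) else - L a (L i x))"
  using L_sort[of i a x] L_sort[of a i x] assms
  by (cases i a rule: linorder_cases) auto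

text \<open>
  Moving \<open>L i\<close> through the three operators of a line costs three signs if \<open>i\<close> is off the line and
  two signs if it is on it; the remaining \<open>L i (L i m)\<close> costs one more.
\<close>

lemma L_conj_fano:
  assumes "(a, b, c) \<in> fano_lines" and i: "i \<in> {1..<8}"
  shows "L i (L a (L b (L c (L i m)))) =
    (if i \<in> {a, b, c} then - L a (L b (L c m)) else L a (L b (L c m)))"
proof -
  have abc: "a \<in> {1..<8}" "b \<in> {1..<8}" "c \<in> {1..<8}" and distinct: "a \<noteq> b" "b \<noteq> c" "a \<noteq> c"
    using assms(1) by (auto simp: fano_lines_def)
  have sq: "L i (L i m) = - m"
    using i by (intro L_square) auto
  show ?thesis
    unfolding L_swap[OF i abc(1)] L_swap[OF i abc(2)] L_swap[OF i abc(3)] sq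
    using distinct by (auto simp: act_simps)
qed

text \<open>
  The analogue of the expansion of an octonion in the units. Eight times the right-hand side
  consists of \<open>8 m\<close> and, for each line, the term \<open>T m\<close> with a total coefficient: \<open>- 1\<close> from the
  real unit, \<open>- 1\<close> from each of the three points on the line and \<open>1\<close> from each of the four points
  off it, so that these contributions cancel.
\<close>

lemma assoc_part_decomposition:
  "m = (\<Sum>i<8. L i (assoc_part (lm (octonion_cnj (octonion_unit i)) m)))"
proof -
  have expand: "8 *\<^sub>R L i (assoc_part x) = L i x - (\<Sum>(a, b, c)\<in>fano_lines. L i (L a (L b (L c x))))"
    for i x
    by (simp add: assoc_part_def act_simps linear_sum[OF linear_act(1)] case_prod_unfold)
  have imaginary: "8 *\<^sub>R L i (assoc_part (lm (octonion_cnj (octonion_unit i)) m)) =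
      m + (\<Sum>(a, b, c)\<in>fano_lines.
        if i \<in> {a, b, c} then - L a (L b (L c m)) else L a (L b (L c m)))"
    if i: "i \<in> {1..<8}" for i
  proof -
    have "(\<Sum>(a, b, c)\<in>fano_lines. L i (L a (L b (L c (L i m))))) =
      (\<Sum>(a, b, c)\<in>fano_lines.
        if i \<in> {a, b, c} then - L a (L b (L c m)) else L a (L b (L c m)))"
      by (rule sum.cong[OF refl]) (use L_conj_fano[OF _ i] in auto)
    with i show ?thesis
      unfolding expand
      by (simp add: octonion_cnj_unit act_simps L_square sum_negf case_prod_unfold)
  qed
  have count: "(\<Sum>i = 1..<8. if i \<in> {a, b, c} then - x else x) = x"
    if abc: "(a, b, c) \<in> fano_lines" for a b c :: nat and x :: 'm
  proof -
    have "card {a, b, c} = 3" "{a, b, c} \<subseteq> {1..<8}"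
      using abc by (auto simp: fano_lines_def)
    then have "(\<Sum>i = 1..<8. if i \<in> {a, b, c} then - 1 else 1 :: real) = 1"
      by (subst sum.subset_diff[of "{a, b, c}"]) (simp_all add: card_Diff_subset del: insert_iff insert_subset)
    moreover have "(if i \<in> {a, b, c} then - x else x) = (if i \<in> {a, b, c} then - 1 else 1 :: real) *\<^sub>R x"
      for i by simp
    ultimately show ?thesis
      by (simp only: scaleR_sum_left[symmetric] scaleR_one)
  qed
  have eight: "8 *\<^sub>R m = m + 7 *\<^sub>R m"
    using scaleR_left_distrib[of 1 7 m] by simp
  have "8 *\<^sub>R (\<Sum>i<8. L i (assoc_part (lm (octonion_cnj (octonion_unit i)) m))) =
    (m - (\<Sum>(a, b, c)\<in>fano_lines. L a (L b (L c m)))) +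
    (\<Sum>i = 1..<8. m + (\<Sum>(a, b, c)\<in>fano_lines.
        if i \<in> {a, b, c} then - L a (L b (L c m)) else L a (L b (L c m))))"
    unfolding scaleR_right.sum lessThan_atLeast0
    by (subst sum.atLeast_Suc_lessThan)
      (simp_all add: imaginary octonion_unit_0 expand[of 0, unfolded octonion_unit_0 act_one])
  also have "\<dots> = 8 *\<^sub>R m + ((\<Sum>(a, b, c)\<in>fano_lines.
        \<Sum>i = 1..<8. if i \<in> {a, b, c} then - L a (L b (L c m)) else L a (L b (L c m)))
        - (\<Sum>(a, b, c)\<in>fano_lines. L a (L b (L c m))))"
    unfolding sum.distrib case_prod_unfold eight
    by (subst (2) sum.swap) (simp add: sum_constant_scaleR algebra_simps)
  also have "(\<Sum>(a, b, c)\<in>fano_lines.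
        \<Sum>i = 1..<8. if i \<in> {a, b, c} then - L a (L b (L c m)) else L a (L b (L c m)))
      = (\<Sum>(a, b, c)\<in>fano_lines. L a (L b (L c m)))"
    by (rule sum.cong[OF refl]) (use count in auto)
  finally show ?thesis by simp
qed

text \<open>
  Two lines meet in one point, so the product of their operators is, up to sign, the product of the
  four operators \<open>L n\<close> over the complement of the third line through that point. When the volume
  element acts as \<open>- 1\<close>, that product is \<open>-\<close> the operator of the third line itself (with
  increasing indices). Hence multiplication by the operator of a line permutes the eight summands of
  \<open>assoc_part m\<close> up to a common sign.
\<close>

lemma fano_L_assoc_part:
  assumes "volume m = - m" and "(i, j, k) \<in> fano_lines"
  shows "L i (L j (L k (assoc_part m))) = - assoc_part m"
proof -
  have m: "m = - volume m" unfolding assms(1) by (rule minus_minus[symmetric])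
  have split: "L a (L b (L c (L d m))) = L a (L b (L c (L d (- volume m))))" for a b c d
    using m by (rule arg_cong)
  \<comment> \<open>The products over the complements of the seven lines.\<close>
  have comp1: "L 4 (L 5 (L 6 (L 7 m))) = - L 1 (L 2 (L 3 m))"
    by (rule trans[OF split[of 4 5 6 7]]) (simp add: volume_def L_normal del: One_nat_def)
  have comp2: "L 2 (L 3 (L 6 (L 7 m))) = - L 1 (L 4 (L 5 m))"
    by (rule trans[OF split[of 2 3 6 7]]) (simp add: volume_def L_normal del: One_nat_def)
  have comp3: "L 1 (L 3 (L 5 (L 7 m))) = - L 2 (L 4 (L 6 m))"
    by (rule trans[OF split[of 1 3 5 7]]) (simp add: volume_def L_normal del: One_nat_def)
  have comp4: "L 1 (L 2 (L 5 (L 6 m))) = - L 3 (L 4 (L 7 m))"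
    by (rule trans[OF split[of 1 2 5 6]]) (simp add: volume_def L_normal del: One_nat_def)
  have comp5: "L 2 (L 3 (L 4 (L 5 m))) = - L 1 (L 6 (L 7 m))"
    by (rule trans[OF split[of 2 3 4 5]]) (simp add: volume_def L_normal del: One_nat_def)
  have comp6: "L 1 (L 3 (L 4 (L 6 m))) = - L 2 (L 5 (L 7 m))"
    by (rule trans[OF split[of 1 3 4 6]]) (simp add: volume_def L_normal del: One_nat_def)
  have comp7: "L 1 (L 2 (L 4 (L 7 m))) = - L 3 (L 5 (L 6 m))"
    by (rule trans[OF split[of 1 2 4 7]]) (simp add: volume_def L_normal del: One_nat_def)
  note comp = comp1 comp2 comp3 comp4 comp5 comp6 comp7
  have P: "8 *\<^sub>R assoc_part m = m - L 1 (L 2 (L 3 m)) - L 1 (L 4 (L 5 m)) - L 2 (L 4 (L 6 m))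
      - L 3 (L 4 (L 7 m)) - L 1 (L 7 (L 6 m)) - L 2 (L 5 (L 7 m)) - L 3 (L 6 (L 5 m))"
    by (simp add: assoc_part_def fano_lines_def algebra_simps)
  have "L i (L j (L k (8 *\<^sub>R assoc_part m))) = - (8 *\<^sub>R assoc_part m)"
    using assms(2) unfolding fano_lines_def
    by (elim insertE emptyE; simp add: P L_normal comp del: One_nat_def)
  then have "8 *\<^sub>R L i (L j (L k (assoc_part m))) = 8 *\<^sub>R (- assoc_part m)"
    by (simp add: act_simps)
  then show ?thesis
    unfolding scaleR_cancel_left by simp
qed

end


section \<open>Generation by associative elements\<close>

context left_octonion_action
begin

lemma assoc_elems_act: "a \<in> assoc_elems lm \<Longrightarrow> lm p (lm q a) = lm (p * q) a"
  by (auto simp: assoc_elems_def)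

lemma assoc_part_act:
  assumes "a \<in> assoc_elems lm"
  shows "assoc_part (lm q a) = octonion_re q *\<^sub>R a"
proof -
  have "8 *\<^sub>R assoc_part (lm q a) = lm (q - (\<Sum>(i, j, k)\<in>fano_lines.
      octonion_unit i * (octonion_unit j * (octonion_unit k * q)))) a"
    by (simp add: assoc_part_def assoc_elems_act[OF assms] act_simps
        linear_sum[OF linear_act(2)] case_prod_unfold)
  also have "\<dots> = 8 *\<^sub>R octonion_re q *\<^sub>R a"
    unfolding fano_lines_real_part by (simp add: act_simps)
  finally show ?thesis
    unfolding scaleR_cancel_left by simp
qed

text \<open>
  On a vector on which the operator of a line is \<open>- 1\<close>, the three operators of the line multiply
  like the corresponding quaternion units.
\<close>

lemma fano_L_pairs:
  assumes line: "(i, j, k) \<in> fano_lines" and n: "L i (L j (L k n)) = - n"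
  shows "L i (L j n) = L k n" "L j (L k n) = L i n" "L k (L i n) = L j n"
proof -
  have ijk: "i \<in> {1..<8}" "j \<in> {1..<8}" "k \<in> {1..<8}" and distinct: "i \<noteq> j" "j \<noteq> k" "i \<noteq> k"
    using line by (auto simp: fano_lines_def)
  have sq: "L i (L i x) = - x" "L j (L j x) = - x" "L k (L k x) = - x" for x
    using ijk by (auto intro: L_square)
  show "L j (L k n) = L i n"
    using arg_cong[OF n, of "L i"] by (simp add: sq act_simps)
  have "L j (L i (L k n)) = n"
    using n L_swap[OF ijk(2,1), of "L k n"] distinct by simp
  then have ik: "- L i (L k n) = L j n"
    using sq(2)[of "L i (L k n)"] by simp
  then show "L k (L i n) = L j n"
    using L_swap[OF ijk(3,1), of n] distinct by simp
  have "L j (L i n) = - L k n"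
    using arg_cong[OF ik, of "L i"] L_swap[OF ijk(2,1), of n] distinct
    by (simp add: sq act_simps)
  then show "L i (L j n) = L k n"
    using L_swap[OF ijk(1,2), of n] distinct by simp
qed

text \<open>
  Every pair of distinct imaginary units lies on a line, so the quaternion relations of the seven
  lines give associativity on all pairs of units, and bilinearity does the rest.
\<close>

lemma assoc_part_in_assoc_elems:
  assumes "volume m = - m"
  shows "assoc_part m \<in> assoc_elems lm"
proof -
  define n where "n = assoc_part m"
  note line = fano_L_pairs[OF _ fano_L_assoc_part[OF assms], folded n_def]
  have line_pair: "lm (octonion_unit i * octonion_unit j) n = L i (L j n)"
    if "(i, j, k) \<in> fano_lines \<or> (j, k, i) \<in> fano_lines \<or> (k, i, j) \<in> fano_lines" for i j k
    using that line fano_lines_mult by auto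
  have units: "lm (octonion_unit i * octonion_unit j) n = L i (L j n)" if ij: "i < 8" "j < 8" for i j
  proof -
    consider "i = 0" | "j = 0" | "i = j" "0 < i" | "i \<in> {1..<8}" "j \<in> {1..<8}" "i \<noteq> j"
      using ij by fastforce
    then show ?thesis
    proof cases
      case 4
      then obtain k where "(i, j, k) \<in> fano_lines \<or> (j, k, i) \<in> fano_lines \<or> (k, i, j) \<in> fano_lines
        \<or> (j, i, k) \<in> fano_lines \<or> (i, k, j) \<in> fano_lines \<or> (k, j, i) \<in> fano_lines"
        by (rule fano_line_through)
      then consider "(i, j, k) \<in> fano_lines \<or> (j, k, i) \<in> fano_lines \<or> (k, i, j) \<in> fano_lines"
        | "(j, i, k) \<in> fano_lines \<or> (i, k, j) \<in> fano_lines \<or> (k, j, i) \<in> fano_lines"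
        by blast
      then show ?thesis
      proof cases
        case 2
        have "octonion_unit i * octonion_unit j = - (octonion_unit j * octonion_unit i)"
          using octonion_unit_anticommute[of i j] octonion_unit_anticommute[of j i] 4
          by (cases i j rule: linorder_cases) auto
        then show ?thesis
          using line_pair[OF 2] L_swap[OF 4(1,2)] 4(3) by (simp add: act_simps)
      qed (rule line_pair)
    qed (use ij in \<open>simp_all add: octonion_unit_0 octonion_mult_1 octonion_unit_square L_square act_simps\<close>)
  qed
  have lin: "linear (\<lambda>p. lm (p * q) n)" "linear (\<lambda>q. lm (p * q) n)" "linear (\<lambda>q. lm p (lm q n))" for p q
    by (auto intro!: linearI simp: octonion_mult_simps act_simps)
  have "lm (p * octonion_unit j) n = lm p (L j n)" if "j < 8" for p j
    using octonion_linear_eqI[OF lin(1) linear_act(2) units] that by blast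
  then have "lm (p * q) n = lm p (lm q n)" for p q
    using octonion_linear_eqI[OF lin(2) lin(3)] by blast
  then show ?thesis
    by (simp add: assoc_elems_def n_def)
qed

lemma volume_add: "volume (x + y) = volume x + volume y"
  by (simp add: volume_def act_simps)

lemma volume_act: "volume (lm q m) = lm q (volume m)"
proof (rule octonion_linear_eqI[where f = "\<lambda>q. volume (lm q m)"])
  show "linear (\<lambda>q. volume (lm q m))"
    by (auto intro!: linearI simp: volume_def act_simps)
  show "linear (\<lambda>q. lm q (volume m))"
    by (rule linear_act)
  show "volume (L i m) = L i (volume m)" if "i < 8" for i
    using less_8_cases[OF that] unfolding volume_def
    by (elim disjE; simp add: octonion_unit_0 L_normal del: One_nat_def)
qed

lemma assoc_elems_generate:
  assumes "volume m = - m"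
  obtains a where "\<And>i. a i \<in> assoc_elems lm" "m = (\<Sum>i<8. L i (a i))"
proof -
  have "volume (lm q m) = - lm q m" for q
    by (simp add: volume_act assms act_simps)
  then show ?thesis
    by (intro that[OF assoc_part_in_assoc_elems assoc_part_decomposition])
qed

end

text \<open>
  Composing the action with the conjugation, an anti-automorphism, gives a left module again, in
  which the associative and the conjugate-associative elements are interchanged.
\<close>

lemma left_octonion_action_conj:
  assumes "left_octonion_action lm"
  shows "left_octonion_action (\<lambda>q. lm (octonion_cnj q))"
proof -
  interpret left_octonion_action lm by fact
  have "left_assoc (\<lambda>q. lm (octonion_cnj q)) p q m = - left_assoc (\<lambda>q. lm (octonion_cnj q)) q p m"
    for p q m
  proof -
    have "lm (octonion_cnj q * octonion_cnj p) m - lm (octonion_cnj p) (lm (octonion_cnj q) m)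
      + (lm (octonion_cnj p * octonion_cnj q) m - lm (octonion_cnj q) (lm (octonion_cnj p) m)) = 0"
      using act_symmetrized[of "octonion_cnj p" "octonion_cnj q" m]
      unfolding bilinear_ladd[OF bilinear_action] by (simp add: algebra_simps)
    then show ?thesis
      by (simp only: left_assoc_def octonion_cnj_mult eq_neg_iff_add_eq_0)
  qed
  moreover have "bilinear (\<lambda>q. lm (octonion_cnj q))"
    unfolding bilinear_def
    using linear_compose[OF linear_octonion_cnj linear_act(2)] linear_act(1)
    by (auto simp: o_def)
  moreover have "lm (octonion_cnj 1) m = m" for m
    by simp
  ultimately show ?thesis
    unfolding left_octonion_action_def left_octonion_module_def by blast
qed

lemma assoc_elems_conj:
  "assoc_elems (\<lambda>q. lm (octonion_cnj q)) = conj_assoc_elems lm"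
proof -
  have "(\<forall>p q. lm (octonion_cnj q * octonion_cnj p) m - lm (octonion_cnj p) (lm (octonion_cnj q) m) = 0)
    \<longleftrightarrow> (\<forall>p q. lm (p * q) m - lm q (lm p m) = 0)" for m
    by (metis octonion_cnj_cnj)
  then show ?thesis
    by (simp add: assoc_elems_def conj_assoc_elems_def octonion_cnj_mult)
qed

context left_octonion_action
begin

text \<open>
  Conjugating the action negates all seven imaginary units and hence, seven being odd, the volume
  element. The \<open>1\<close> eigenspace of the volume element is therefore generated by conjugate-associative
  elements and vanishes together with them.
\<close>

lemma volume_eq_uminus:
  assumes "conj_assoc_elems lm = {0}"
  shows "volume m = - m"
proof -
  interpret conj: left_octonion_action "\<lambda>q. lm (octonion_cnj q)"
    using left_octonion_action_axioms by (rule left_octonion_action_conj)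
  \<comment> \<open>Twice the component of \<open>m\<close> in the \<open>1\<close> eigenspace, as the volume element is an involution.\<close>
  define x where "x = m + volume m"
  have "conj.volume y = - volume y" for y
    by (simp add: conj.volume_def volume_def octonion_cnj_unit act_simps del: One_nat_def)
  moreover have "volume x = x"
    by (simp add: x_def volume_volume volume_add add.commute)
  ultimately have "conj.volume x = - x"
    by simp
  then obtain a where a: "\<And>i. a i \<in> conj_assoc_elems lm"
      and x: "x = (\<Sum>i<8. lm (octonion_cnj (octonion_unit i)) (a i))"
    using conj.assoc_elems_generate[of x, unfolded assoc_elems_conj] by metis
  have "x = 0"
    using a assms by (simp add: x act_simps)
  then show ?thesis
    by (simp add: x_def eq_neg_iff_add_eq_0 add.commute)
qed

end


section \<open>Octonionic bases\<close>

lemma octonion_direct_sum_closed: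
  assumes "f \<in> octonion_direct_sum S"
  shows "g \<in> octonion_direct_sum S \<Longrightarrow> (\<lambda>i. f i + g i) \<in> octonion_direct_sum S"
    and "(\<lambda>i. r *\<^sub>R f i) \<in> octonion_direct_sum S"
    and "(\<lambda>i. q * f i) \<in> octonion_direct_sum S"
    and "(\<lambda>i. f i * q) \<in> octonion_direct_sum S"
proof -
  have f: "finite {i. f i \<noteq> 0}" "{i. f i \<noteq> 0} \<subseteq> S"
    using assms by (auto simp: octonion_direct_sum_def)
  show "(\<lambda>i. f i + g i) \<in> octonion_direct_sum S" if "g \<in> octonion_direct_sum S"
  proof -
    have g: "finite {i. g i \<noteq> 0}" "{i. g i \<noteq> 0} \<subseteq> S"
      using that by (auto simp: octonion_direct_sum_def)
    have "{i. f i + g i \<noteq> 0} \<subseteq> {i. f i \<noteq> 0} \<union> {i. g i \<noteq> 0}"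
      by auto
    then show ?thesis
      unfolding octonion_direct_sum_def using f g by (blast intro: finite_subset finite_UnI)
  qed
  have "{i. r *\<^sub>R f i \<noteq> 0} \<subseteq> {i. f i \<noteq> 0}" "{i. q * f i \<noteq> 0} \<subseteq> {i. f i \<noteq> 0}"
    "{i. f i * q \<noteq> 0} \<subseteq> {i. f i \<noteq> 0}"
    by (auto simp: octonion_mult_simps)
  then show "(\<lambda>i. r *\<^sub>R f i) \<in> octonion_direct_sum S" "(\<lambda>i. q * f i) \<in> octonion_direct_sum S"
    "(\<lambda>i. f i * q) \<in> octonion_direct_sum S"
    unfolding octonion_direct_sum_def using f by (blast intro: finite_subset)+
qed

context left_octonion_action
begin

text \<open>
  For a family \<open>g\<close> of associative elements this is the left linear map from the direct sum that
  sends the standard generators to \<open>g\<close>.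
\<close>

definition combination :: "('s \<Rightarrow> 'm) \<Rightarrow> ('s \<Rightarrow> octonion) \<Rightarrow> 'm" where
  "combination g f = (\<Sum>s | f s \<noteq> 0. lm (f s) (g s))"

lemma combination_eq:
  assumes "finite F" "{s. f s \<noteq> 0} \<subseteq> F"
  shows "combination g f = (\<Sum>s\<in>F. lm (f s) (g s))"
  unfolding combination_def
  by (rule sum.mono_neutral_left) (use assms in \<open>auto simp: act_simps\<close>)

lemma combination_linear:
  assumes f: "f \<in> octonion_direct_sum S"
  shows "h \<in> octonion_direct_sum S \<Longrightarrow> combination g (\<lambda>s. f s + h s) = combination g f + combination g h"
    and "combination g (\<lambda>s. r *\<^sub>R f s) = r *\<^sub>R combination g f"
    and "(\<And>s. s \<in> S \<Longrightarrow> g s \<in> assoc_elems lm) \<Longrightarrow> combination g (\<lambda>s. q * f s) = lm q (combination g f)"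
proof -
  let ?F = "{s. f s \<noteq> 0}"
  have F: "finite ?F" "?F \<subseteq> S"
    using f by (auto simp: octonion_direct_sum_def)
  show "combination g (\<lambda>s. f s + h s) = combination g f + combination g h"
    if "h \<in> octonion_direct_sum S"
  proof -
    have fin: "finite (?F \<union> {s. h s \<noteq> 0})"
      using that F by (auto simp: octonion_direct_sum_def)
    show ?thesis
      unfolding combination_eq[OF fin Un_upper1] combination_eq[OF fin Un_upper2]
      by (subst combination_eq[OF fin]) (auto simp: act_simps sum.distrib)
  qed
  show "combination g (\<lambda>s. r *\<^sub>R f s) = r *\<^sub>R combination g f"
    by (subst (1 2) combination_eq[OF F(1)]) (auto simp: act_simps scaleR_right.sum)
  assume g: "\<And>s. s \<in> S \<Longrightarrow> g s \<in> assoc_elems lm"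
  have "lm (q * f s) (g s) = lm q (lm (f s) (g s))" if "s \<in> ?F" for s
    using assoc_elems_act[OF g] that F(2) by auto
  then show "combination g (\<lambda>s. q * f s) = lm q (combination g f)"
    by (subst (1 2) combination_eq[OF F(1)])
      (auto simp: octonion_mult_simps linear_sum[OF linear_act(1)])
qed

text \<open>
  Linear independence over the reals implies linear independence over the octonions: after
  multiplication by the conjugate of a unit, \<open>assoc_part\<close> turns an octonionic relation into the
  real relation between the corresponding coordinates.
\<close>

lemma combination_eq_0_imp:
  assumes basis: "independent B" "B \<subseteq> assoc_elems lm" "inj_on g S" "g ` S \<subseteq> B"
    and f: "f \<in> octonion_direct_sum S" and zero: "combination g f = 0"
  shows "f = (\<lambda>s. 0)"
proof (rule ext, rule octonion_eq_0I)
  fix s and i :: nat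
  let ?F = "{s. f s \<noteq> 0}"
  let ?q = "octonion_cnj (octonion_unit i)"
  have F: "finite ?F" "?F \<subseteq> S"
    using f by (auto simp: octonion_direct_sum_def)
  have g: "g t \<in> assoc_elems lm" if "t \<in> S" for t
    using basis that by auto
  have "0 = assoc_part (lm ?q (combination g f))"
    by (simp add: zero act_simps linear_0[OF linear_assoc_part])
  also have "\<dots> = (\<Sum>t\<in>?F. assoc_part (lm (?q * f t) (g t)))"
    unfolding combination_def linear_sum[OF linear_act(1)] linear_sum[OF linear_assoc_part]
    by (rule sum.cong) (use g F assoc_elems_act in auto)
  also have "\<dots> = (\<Sum>t\<in>?F. octonion_re (?q * f t) *\<^sub>R g t)"
    by (rule sum.cong) (use g F assoc_part_act in auto)
  also have "\<dots> = (\<Sum>v\<in>g ` ?F. octonion_re (?q * f (the_inv_into ?F g v)) *\<^sub>R v)"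
    using inj_on_subset[OF basis(3) F(2)]
    by (subst sum.reindex) (auto intro!: sum.cong simp: the_inv_into_f_f)
  finally have sum: "(\<Sum>v\<in>g ` ?F. octonion_re (?q * f (the_inv_into ?F g v)) *\<^sub>R v) = 0"
    by simp
  show "octonion_re (?q * f s) = 0"
  proof (cases "s \<in> ?F")
    case True
    have "octonion_re (?q * f (the_inv_into ?F g (g s))) = 0"
      by (rule independentD[OF basis(1) _ _ sum]) (use F basis(4) True in auto)
    then show ?thesis
      using inj_on_subset[OF basis(3) F(2)] True by (simp add: the_inv_into_f_f)
  next
    case False
    moreover have "octonion_re 0 = 0"
      by (simp add: octonion_re_def zero_octonion_def)
    ultimately show ?thesis
      by (simp add: octonion_mult_simps)
  qed
qed

text \<open>
  The image is a left submodule that contains a basis of the associative elements, and these generate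
  the module.
\<close>

lemma combination_surj:
  assumes conj: "conj_assoc_elems lm = {0}" and B: "span B = assoc_elems lm" "g ` S = B"
  shows "combination g ` octonion_direct_sum S = UNIV"
proof -
  let ?R = "combination g ` octonion_direct_sum S"
  have g: "g s \<in> assoc_elems lm" if "s \<in> S" for s
    using B that by (metis imageI span_base)
  have zero: "(\<lambda>s. 0) \<in> octonion_direct_sum S" "combination g (\<lambda>s. 0) = 0"
    by (simp_all add: octonion_direct_sum_def combination_def)
  have R: "subspace ?R"
  proof (rule subspaceI)
    show "0 \<in> ?R"
      using zero by (metis imageI)
    show "x + y \<in> ?R" if "x \<in> ?R" "y \<in> ?R" for x y
    proof -
      obtain f h where fh: "f \<in> octonion_direct_sum S" "h \<in> octonion_direct_sum S"
        and xy: "x = combination g f" "y = combination g h"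
        using \<open>x \<in> ?R\<close> \<open>y \<in> ?R\<close> by blast
      show ?thesis
        unfolding xy combination_linear(1)[OF fh, symmetric]
        using octonion_direct_sum_closed(1)[OF fh] by blast
    qed
    show "r *\<^sub>R x \<in> ?R" if "x \<in> ?R" for r x
    proof -
      obtain f where f: "f \<in> octonion_direct_sum S" "x = combination g f"
        using \<open>x \<in> ?R\<close> by blast
      show ?thesis
        unfolding f(2) combination_linear(2)[OF f(1), symmetric]
        using octonion_direct_sum_closed(2)[OF f(1)] by blast
    qed
  qed
  have R_act: "lm q x \<in> ?R" if "x \<in> ?R" for q x
  proof -
    obtain f where "f \<in> octonion_direct_sum S" "x = combination g f"
      using \<open>x \<in> ?R\<close> by blast
    then have "lm q x = combination g (\<lambda>s. q * f s)" "(\<lambda>s. q * f s) \<in> octonion_direct_sum S"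
      using combination_linear(3)[of f S g q] octonion_direct_sum_closed(3) g by auto
    then show ?thesis by blast
  qed
  have "g s \<in> ?R" if "s \<in> S" for s
  proof -
    have one: "(1::octonion) \<noteq> 0"
      by (simp add: octonion_arith_defs zero_prod_def)
    let ?f = "\<lambda>t. if t = s then 1 else 0 :: octonion"
    have supp: "{t. ?f t \<noteq> 0} = {s}"
      using one by auto
    have "?f \<in> octonion_direct_sum S"
      unfolding octonion_direct_sum_def using that by (simp add: supp)
    moreover have "combination g ?f = g s"
      unfolding combination_def supp by simp
    ultimately show ?thesis
      by (metis imageI)
  qed
  then have "span B \<subseteq> ?R"
    by (intro span_minimal R) (use B(2) in blast)
  then have A: "assoc_elems lm \<subseteq> ?R"
    using B(1) by simp
  have "m \<in> ?R" for m
  proof -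
    obtain a where a: "\<And>i. a i \<in> assoc_elems lm" and m: "m = (\<Sum>i<8. L i (a i))"
      using assoc_elems_generate[OF volume_eq_uminus[OF conj]] by metis
    show ?thesis
      unfolding m by (intro subspace_sum[OF R] R_act) (use a A in blast)
  qed
  then show ?thesis by blast
qed

lemma left_free:
  assumes conj: "conj_assoc_elems lm = {0}"
    and B: "independent B" "span B = assoc_elems lm" and g: "bij_betw g S B"
  obtains \<phi> where "bij_betw \<phi> UNIV (octonion_direct_sum S)"
    "\<And>x y. \<phi> (x + y) = (\<lambda>s. \<phi> x s + \<phi> y s)"
    "\<And>r x. \<phi> (r *\<^sub>R x) = (\<lambda>s. r *\<^sub>R \<phi> x s)"
    "\<And>q x. \<phi> (lm q x) = (\<lambda>s. q * \<phi> x s)"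
proof -
  let ?D = "octonion_direct_sum S"
  have gA: "g s \<in> assoc_elems lm" if "s \<in> S" for s
    using B(2) g that by (metis bij_betwE span_base)
  have inj: "inj_on (combination g) ?D"
  proof (rule inj_onI)
    fix f h assume fh: "f \<in> ?D" "h \<in> ?D" "combination g f = combination g h"
    let ?d = "\<lambda>s. f s + (- 1) *\<^sub>R h s"
    note neg = octonion_direct_sum_closed(2)[OF fh(2), of "- 1"]
    have "?d \<in> ?D"
      by (rule octonion_direct_sum_closed(1)[OF fh(1) neg])
    moreover have "combination g ?d = 0"
      using combination_linear(1)[OF fh(1) neg, of g] combination_linear(2)[OF fh(2), of g "- 1"] fh(3)
      by simp
    moreover have "B \<subseteq> assoc_elems lm" "inj_on g S" "g ` S \<subseteq> B"
      using g span_superset[of B] unfolding B(2) bij_betw_def by blast+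
    ultimately have "?d = (\<lambda>s. 0)"
      by (intro combination_eq_0_imp[OF B(1)])
    then have "?d s = 0" for s
      by (rule fun_cong)
    then show "f = h"
      by (auto simp: fun_eq_iff)
  qed
  have surj: "combination g ` ?D = UNIV"
    by (rule combination_surj[OF conj B(2)]) (use g in \<open>simp add: bij_betw_def\<close>)
  define \<phi> where "\<phi> = the_inv_into ?D (combination g)"
  have \<phi>: "\<phi> x \<in> ?D" "combination g (\<phi> x) = x" for x
    using the_inv_into_into[OF inj _ subset_refl] f_the_inv_into_f[OF inj] surj
    by (auto simp: \<phi>_def)
  have \<phi>_eqI: "\<phi> x = f" if "f \<in> ?D" "combination g f = x" for x f
    unfolding \<phi>_def using the_inv_into_f_eq[OF inj that(2,1)] .
  show ?thesis
  proof
    show "bij_betw \<phi> UNIV ?D"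
      unfolding \<phi>_def using bij_betw_the_inv_into[of "combination g" ?D UNIV] inj surj
      by (simp add: bij_betw_def)
    show "\<phi> (x + y) = (\<lambda>s. \<phi> x s + \<phi> y s)" for x y
      by (rule \<phi>_eqI) (simp_all add: octonion_direct_sum_closed combination_linear(1)[OF \<phi>(1) \<phi>(1)] \<phi>)
    show "\<phi> (r *\<^sub>R x) = (\<lambda>s. r *\<^sub>R \<phi> x s)" for r x
      by (rule \<phi>_eqI) (simp_all add: octonion_direct_sum_closed combination_linear(2)[OF \<phi>(1)] \<phi>)
    show "\<phi> (lm q x) = (\<lambda>s. q * \<phi> x s)" for q x
      by (rule \<phi>_eqI) (simp_all add: octonion_direct_sum_closed combination_linear(3)[OF \<phi>(1) gA] \<phi>)
  qed
qed

text \<open>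
  The bimodule axioms are identities, and they hold in each component of the direct sum because the
  octonions are a bimodule over themselves.
\<close>

lemma bimodule_transport:
  fixes \<phi> :: "'m \<Rightarrow> 's \<Rightarrow> octonion"
  assumes bij: "bij_betw \<phi> UNIV (octonion_direct_sum S)"
    and add: "\<And>x y. \<phi> (x + y) = (\<lambda>s. \<phi> x s + \<phi> y s)"
    and scale: "\<And>r x. \<phi> (r *\<^sub>R x) = (\<lambda>s. r *\<^sub>R \<phi> x s)"
    and left: "\<And>q x. \<phi> (lm q x) = (\<lambda>s. q * \<phi> x s)"
  shows "\<exists>rm. octonion_bimodule lm rm \<and> bimodule_iso_direct_sum lm rm S"
proof -
  have inj: "inj \<phi>"
    using bij by (simp add: bij_betw_def)
  have eqI: "x = y" if "\<And>s. \<phi> x s = \<phi> y s" for x y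
    by (rule injD[OF inj]) (use that in auto)
  have "\<exists>y. \<phi> y = (\<lambda>s. \<phi> x s * q)" for x q
  proof -
    have "\<phi> x \<in> octonion_direct_sum S"
      using bij by (auto simp: bij_betw_def)
    then have "(\<lambda>s. \<phi> x s * q) \<in> range \<phi>"
      using bij octonion_direct_sum_closed(4) by (auto simp: bij_betw_def)
    then show ?thesis by (metis imageE)
  qed
  then obtain rm where right: "\<phi> (rm x q) = (\<lambda>s. \<phi> x s * q)" for x q
    by metis
  have neg: "\<phi> (- x) = (\<lambda>s. - \<phi> x s)" for x
    using scale[of "- 1" x] by simp
  have diff: "\<phi> (x - y) = (\<lambda>s. \<phi> x s - \<phi> y s)" for x y
    using add[of x "- y"] by (simp add: neg)
  note \<phi> = add scale left right neg diff
  have bimod: "left_assoc (*) p q x = mid_assoc (*) (*) q x p"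
    "mid_assoc (*) (*) q x p = right_assoc (*) x p q"
    "right_assoc (*) x p q = - right_assoc (*) x q p" for p q x :: octonion
    using octonion_bimodule_self
    unfolding octonion_bimodule_def right_octonion_module_def by blast+
  have "bilinear rm"
    unfolding bilinear_def by (auto intro!: linearI eqI simp: \<phi> octonion_mult_simps)
  moreover have "rm x 1 = x" for x
    by (rule eqI) (simp add: \<phi> octonion_mult_1)
  moreover have "right_assoc rm x p q = - right_assoc rm x q p" for x p q
    using bimod(3) by (intro eqI) (simp add: \<phi> right_assoc_def)
  moreover have "left_assoc lm p q x = mid_assoc lm rm q x p" for p q x
    using bimod(1)[of p q] by (intro eqI) (simp add: \<phi> left_assoc_def mid_assoc_def)
  moreover have "mid_assoc lm rm q x p = right_assoc rm x p q" for p q x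
    using bimod(2)[of q _ p] by (intro eqI) (simp add: \<phi> right_assoc_def mid_assoc_def)
  ultimately have "octonion_bimodule lm rm"
    unfolding octonion_bimodule_def right_octonion_module_def using left_module by blast
  moreover have "bimodule_iso_direct_sum lm rm S"
    unfolding bimodule_iso_direct_sum_def
    by (intro exI[of _ \<phi>] conjI allI bij \<phi>)
  ultimately show ?thesis by blast
qed

lemma free_bimodule:
  assumes "conj_assoc_elems lm = {0}"
    and "independent B" "span B = assoc_elems lm" and "bij_betw g S B"
  shows "\<exists>rm. octonion_bimodule lm rm \<and> bimodule_iso_direct_sum lm rm S"
  by (rule left_free[OF assms]) (rule bimodule_transport)

end


section \<open>Associators in bimodules\<close>

locale octonion_bimodule_action = left_octonion_action lm
  for lm :: "octonion \<Rightarrow> 'm::real_vector \<Rightarrow> 'm" +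
  fixes rm :: "'m \<Rightarrow> octonion \<Rightarrow> 'm"
  assumes bimodule: "octonion_bimodule lm rm"
begin

lemma bilinear_right: "bilinear rm"
  using bimodule by (simp add: octonion_bimodule_def right_octonion_module_def)

lemma right_one: "rm m 1 = m"
  using bimodule by (simp add: octonion_bimodule_def right_octonion_module_def)

lemmas right_simps =
  bilinear_ladd[OF bilinear_right] bilinear_radd[OF bilinear_right]
  bilinear_lsub[OF bilinear_right] bilinear_rsub[OF bilinear_right]
  bilinear_lzero[OF bilinear_right] bilinear_rzero[OF bilinear_right]

lemma mid_assoc_eq: "mid_assoc lm rm q m p = left_assoc lm p q m"
  and right_assoc_eq: "right_assoc rm m p q = left_assoc lm p q m"
  using bimodule unfolding octonion_bimodule_def by metis+

text \<open>
  In any nonassociative algebra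
  \<open>[p q, x, r] - [p, q x, r] + [p, q, x r] = p [q, x, r] + [p, q, x] r\<close>, as both sides expand to the
  same products. The two lemmas are this identity with the module element in different positions,
  where the bimodule axioms turn every associator into one of the form \<open>[p, q, m]\<close>.
\<close>

lemma teichmueller_middle:
  "left_assoc lm r (p * q) m - left_assoc lm r p (lm q m) + left_assoc lm p q (rm m r)
     = lm p (left_assoc lm r q m) + rm (left_assoc lm p q m) r"
  unfolding mid_assoc_eq[of _ _ r, symmetric]
  by (simp add: mid_assoc_def left_assoc_def act_simps right_simps)

lemma teichmueller_right:
  "left_assoc lm p q (rm m r) - left_assoc lm (r * p) q m + left_assoc lm r (p * q) m
     = rm (left_assoc lm r p m) q + rm m (left_assoc (*) r p q)"
  unfolding right_assoc_eq[symmetric]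
  by (simp add: right_assoc_def left_assoc_def right_simps)

text \<open>
  For associative \<open>a\<close> all associators with \<open>a\<close> vanish, and the two identities say that
  \<open>[p, q, a r]\<close> equals both \<open>[r, p, q] a\<close> and \<open>a [r, p, q]\<close>. So \<open>a\<close> commutes with all associators,
  which span the imaginary octonions.
\<close>

lemma assoc_elems_commute:
  assumes "a \<in> assoc_elems lm"
  shows "rm a x = lm x a"
proof -
  have A: "left_assoc lm p q a = 0" for p q
    using assms by (simp add: assoc_elems_def left_assoc_def)
  have associator: "rm a (left_assoc (*) r p q) = lm (left_assoc (*) r p q) a" for p q r
  proof -
    have "rm a (left_assoc (*) r p q) = left_assoc lm p q (rm a r)"
      using teichmueller_right[of p q a r] by (simp add: A right_simps)
    also have "\<dots> = left_assoc lm r p (lm q a)"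
      using teichmueller_middle[of r p q a] by (simp add: A act_simps right_simps)
    also have "\<dots> = lm (left_assoc (*) r p q) a"
      by (simp add: left_assoc_def assoc_elems_act[OF assms] act_simps)
    finally show ?thesis .
  qed
  show ?thesis
  proof (rule octonion_linear_eqI[where f = "rm a"])
    show "linear (rm a)"
      using bilinear_right by (simp add: bilinear_def)
    show "linear (\<lambda>x. lm x a)"
      by (rule linear_act)
    show "rm a (octonion_unit i) = L i a" if "i < 8" for i
    proof (cases "i = 0")
      case True
      then show ?thesis by (simp add: octonion_unit_0 right_one)
    next
      case False
      then obtain p q r where "octonion_unit i = left_assoc (*) p q r"
        using octonion_unit_associator[of i] \<open>i < 8\<close> by auto
      then show ?thesis by (simp add: associator)
    qed
  qed
qed

text \<open>
  The right action is thus determined by the left action wherever the associative elements generate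
  the module.
\<close>

lemma right_action_on_generators:
  assumes "\<And>i. a i \<in> assoc_elems lm"
  shows "rm (\<Sum>i<8. L i (a i)) x = (\<Sum>i<8. lm (octonion_unit i * x) (a i))"
proof -
  have "rm (lm q (a i)) x = lm (q * x) (a i)" for q i
    using mid_assoc_eq[of q "a i" x] assms[of i]
    by (simp add: mid_assoc_def left_assoc_def assoc_elems_commute assoc_elems_act)
  moreover have lin: "linear (\<lambda>m. rm m x)"
    using bilinear_right by (simp add: bilinear_def)
  ultimately show ?thesis
    unfolding linear_sum[OF lin] by simp
qed

text \<open>
  For a conjugate-associative \<open>m\<close> the left action determines \<open>[p, q, m]\<close> as \<open>(p q - q p) m\<close>. The two
  identities on the quaternion subalgebra of \<open>e\<^sub>1\<close> and \<open>e\<^sub>2\<close> then force \<open>m e\<^sub>1 = - e\<^sub>1 m\<close>, as if the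
  right action were conjugate to the left one. With \<open>e\<^sub>4\<close>, which lies outside this subalgebra, the
  first identity reduces to \<open>e\<^sub>7 m = 0\<close>.
\<close>

lemma conj_assoc_elems_trivial: "conj_assoc_elems lm = {0}"
proof -
  have "m = 0" if "m \<in> conj_assoc_elems lm" for m
  proof -
    have act: "lm p (lm q m) = lm (q * p) m" for p q
      using that by (simp add: conj_assoc_elems_def)
    have A: "left_assoc lm p q m = lm (p * q - q * p) m" for p q
      by (simp add: left_assoc_def act act_simps)
    have right_A: "rm (left_assoc lm p q m) r
        = lm (p * q - q * p) (rm m r) + lm (r * (p * q - q * p) - (p * q - q * p) * r) m" for p q r
      using mid_assoc_eq[of "p * q - q * p" m r] unfolding A mid_assoc_def
      by (metis add.commute diff_add_cancel)
    have eq_uminus: "x = 0" if "x = - x" for x :: 'm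
    proof -
      have "2 *\<^sub>R x = 0"
        using that by (simp only: scaleR_2 eq_neg_iff_add_eq_0)
      then show ?thesis by simp
    qed
    have diagonal: "left_assoc lm p p x = 0" for p x
      using left_module unfolding left_octonion_module_def by (intro eq_uminus) blast
    let ?e = octonion_unit
    \<comment> \<open>Comparing the two identities with \<open>r = p\<close> eliminates \<open>[p, q, m p]\<close> and leaves an equation
      between \<open>m p\<close> and the left action.\<close>
    have associator: "left_assoc lm p q (rm m p) = lm (p * p * q - q * (p * p) - (p * (p * q) - p * q * p)) m"
      if "left_assoc (*) p p q = 0" for p q
    proof -
      have "left_assoc lm p q (rm m p) - lm (p * p * q - q * (p * p)) m
          + lm (p * (p * q) - p * q * p) m = 0"
        using teichmueller_right[of p q m p] by (simp add: that diagonal right_simps flip: A)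
      then have "left_assoc lm p q (rm m p) =
          lm (p * p * q - q * (p * p)) m - lm (p * (p * q) - p * q * p) m"
        by (simp only: eq_neg_iff_add_eq_0[symmetric] diff_eq_eq) simp
      then show ?thesis
        by (simp add: act_simps)
    qed
    have step: "lm (p * q - q * p) (rm m p) = lm (p * p * q - q * (p * p) - p * (p * q - q * p)) m"
      if "left_assoc (*) p p q = 0" for p q
      using teichmueller_middle[of p p q m]
      unfolding diagonal right_A associator[OF that]
      unfolding A act
      by (simp add: act_simps octonion_mult_simps algebra_simps)
    have table:
      "?e 1 * ?e 2 = ?e 3" "?e 2 * ?e 1 = - ?e 3" "?e 1 * ?e 3 = - ?e 2"
      "?e 3 * ?e 1 = ?e 2" "?e 2 * ?e 3 = ?e 1" "?e 1 * ?e 4 = ?e 5"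
      "?e 4 * ?e 1 = - ?e 5" "?e 2 * ?e 4 = ?e 6" "?e 4 * ?e 2 = - ?e 6"
      "?e 1 * ?e 6 = - ?e 7" "?e 6 * ?e 1 = ?e 7" "?e 2 * ?e 5 = ?e 7"
      "?e 5 * ?e 2 = - ?e 7" "?e 4 * ?e 3 = - ?e 7" "?e 1 * ?e 1 = - 1"
      by (simp_all add: octonion_unit_def octonion_arith_defs zero_prod_def)
    have "2 *\<^sub>R L 3 (rm m (?e 1)) = 2 *\<^sub>R L 2 m"
      using step[of "?e 1" "?e 2"]
      by (simp add: left_assoc_def table octonion_mult_simps octonion_mult_1 act_simps scaleR_2
          del: One_nat_def)
    then have "L 3 (L 3 (rm m (?e 1))) = L 3 (L 2 m)"
      unfolding scaleR_cancel_left by simp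
    then have right: "rm m (?e 1) = - L 1 m"
      by (simp add: L_square act table del: One_nat_def) (metis minus_minus)
    \<comment> \<open>Unfolding \<open>right_A\<close> comes before \<open>A\<close>, which would rewrite the associator on its left-hand side.\<close>
    have "- L 7 m = L 7 m"
      using teichmueller_middle[of "?e 1" "?e 2" "?e 4" m]
      unfolding right_A
      unfolding right A
      by (simp add: left_assoc_def act_simps act table octonion_mult_simps del: One_nat_def)
    then have "L 7 m = 0"
      using eq_uminus[of "L 7 m"] by simp
    then have "L 7 (L 7 m) = 0"
      by (simp add: act_simps)
    then show ?thesis
      by (simp add: L_square)
  qed
  moreover have "0 \<in> conj_assoc_elems lm"
    by (simp add: conj_assoc_elems_def act_simps)
  ultimately show ?thesis by blast
qed

end


section \<open>Classification\<close>

theorem corollary4p9: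
  fixes lm :: "octonion \<Rightarrow> 'm::real_vector \<Rightarrow> 'm"
    and \<mu> :: "'k rel" and \<nu> :: "'l rel"
  assumes "left_octonion_module lm"
    and "Card_order \<mu>" and "Card_order \<nu>"
    and "module_has_type lm \<mu> \<nu>"
  shows "((\<exists>rm. octonion_bimodule lm rm) \<longleftrightarrow> \<nu> =o (czero :: 'l rel)) \<and>
         (\<nu> =o (czero :: 'l rel) \<longleftrightarrow> conj_assoc_elems lm = {0}) \<and>
         (\<nu> =o (czero :: 'l rel) \<longrightarrow>
            (\<exists>!rm. octonion_bimodule lm rm) \<and>
            (\<forall>rm (S :: 's set). octonion_bimodule lm rm \<longrightarrow> |S| =o \<mu> \<longrightarrow>
               bimodule_iso_direct_sum lm rm S))"
proof -
  interpret left_octonion_action lm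
    using assms(1) by unfold_locales
  obtain B C where B: "independent B" "span B = assoc_elems lm" "|B| =o \<mu>"
    and C: "independent C" "span C = conj_assoc_elems lm" "|C| =o \<nu>"
    using assms(4) unfolding module_has_type_def has_real_dim_def by blast
  have zero: "\<nu> =o (czero :: 'l rel) \<longleftrightarrow> conj_assoc_elems lm = {0}"
  proof -
    have "\<nu> =o (czero :: 'l rel) \<longleftrightarrow> C = {}"
    proof
      assume "\<nu> =o (czero :: 'l rel)"
      then show "C = {}"
        using ordIso_transitive[OF C(3)] card_of_empty2 unfolding czero_def by blast
    next
      assume "C = {}"
      then have "|C| =o (czero :: 'l rel)"
        by (simp add: czero_def card_of_empty_ordIso)
      then show "\<nu> =o (czero :: 'l rel)"
        using ordIso_transitive[OF ordIso_symmetric[OF C(3)]] by blast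
    qed
    also have "\<dots> \<longleftrightarrow> span C = {0}"
      using C(1) by (metis dependent_zero insertI1 span_base singletonD span_empty equals0I)
    finally show ?thesis
      by (simp add: C(2))
  qed
  have trivial: "conj_assoc_elems lm = {0}" if "octonion_bimodule lm rm" for rm
  proof -
    interpret octonion_bimodule_action lm rm
      by unfold_locales (rule that)
    show ?thesis
      by (rule conj_assoc_elems_trivial)
  qed
  have unique: "rm = rm'" if rm: "octonion_bimodule lm rm" and rm': "octonion_bimodule lm rm'" for rm rm'
  proof (intro ext)
    fix m x
    interpret R: octonion_bimodule_action lm rm
      by unfold_locales (rule rm)
    interpret R': octonion_bimodule_action lm rm'
      by unfold_locales (rule rm')
    obtain a where "\<And>i. a i \<in> assoc_elems lm" "m = (\<Sum>i<8. L i (a i))"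
      using assoc_elems_generate[OF volume_eq_uminus[OF trivial[OF rm]]] by metis
    then show "rm m x = rm' m x"
      using R.right_action_on_generators R'.right_action_on_generators by metis
  qed
  \<comment> \<open>The type of \<open>S\<close> may be too small for a basis, so the basis \<open>B\<close> is indexed by itself.\<close>
  have exist: "\<exists>rm. octonion_bimodule lm rm" if "conj_assoc_elems lm = {0}"
    using free_bimodule[OF that B(1,2) bij_betw_id] by blast
  have iso: "bimodule_iso_direct_sum lm rm S" if rm: "octonion_bimodule lm rm" and S: "|S| =o \<mu>"
    for rm and S :: "'s set"
  proof -
    have "|S| =o |B|"
      using ordIso_transitive[OF S ordIso_symmetric[OF B(3)]] .
    then obtain g where g: "bij_betw g S B"
      using card_of_ordIso by blast
    obtain rm' where "octonion_bimodule lm rm'" and iso: "bimodule_iso_direct_sum lm rm' S"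
      using free_bimodule[OF trivial[OF rm] B(1,2) g] by blast
    then have "rm' = rm"
      using unique rm by blast
    with iso show ?thesis by simp
  qed
  show ?thesis
  proof (intro conjI impI allI)
    show "(\<exists>rm. octonion_bimodule lm rm) \<longleftrightarrow> \<nu> =o (czero :: 'l rel)"
      unfolding zero using trivial exist by blast
    show "\<nu> =o (czero :: 'l rel) \<longleftrightarrow> conj_assoc_elems lm = {0}"
      by (rule zero)
    show "\<exists>!rm. octonion_bimodule lm rm" if \<nu>: "\<nu> =o (czero :: 'l rel)"
    proof -
      obtain rm where rm: "octonion_bimodule lm rm"
        using exist[OF iffD1[OF zero \<nu>]] by blast
      show ?thesis
      proof (rule ex1I)
        show "octonion_bimodule lm rm"
          by (rule rm)
      qed (rule unique[OF _ rm])
    qed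
  qed (rule iso)
qed

end
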